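(* Let $Y$ be a smooth variety, let $\pi\colon X\to Y$ be a flat $D_3$-cover with $X$ normal, let $W:=X/\langle\tau\rangle$ and let $f\colon W\to Y$ be the induced triple cover. Under the identification $f_*\mathcal{O}_W\cong\mathcal{O}_Y\oplus U_1$, $U_1$ coincides with the Tschirnhausen module $E$ of $\mathcal{O}_W$ over $\mathcal{O}_Y$, that is, $U_1$ consists of the elements of $\mathcal{O}_W$ whose minimal cubic polynomial has no square term. Furthermore, the triple cover homomorphism $\phi_2\colon E\otimes E\to E$ coincides with $m_{11}\colon U_1\otimes U_1\to U_1$.
   Context: Varieties are over $\mathbb{C}$. $D_3=\langle\sigma,\tau\mid\sigma^3=\tau^2=(\sigma\tau)^2=1\rangle$. A $D_3$-cover is a finite morphism $\pi\colon X\to Y$ with an effective $D_3$-action on $X$ such that $\pi$ is invariant and $X/D_3\cong Y$. Write $\pi_*\mathcal{O}_X=\mathcal{O}_Y\oplus\mathcal{L}\oplus U_1\oplus U_2$, where $\mathcal{O}_Y\oplus\mathcal{L}$ is the subsheaf of $\sigma$-invariants ($\tau^*$ acting as $+1$ on $\mathcal{O}_Y$ and as $-1$ on $\mathcal{L}$) and $U_j$ ($j=1,2$) is the rank 2 subbundle of functions $h$ with $\sigma^*h=\exp(2\pi\sqrt{-1}\,j/3)h$. The involution $\tau$ induces an isomorphism $\tau^*\colon U_1\to U_2$, with inverse $\tau^*\colon U_2\to U_1$. The identification $\mathcal{O}_Y\oplus U_1\cong f_*\mathcal{O}_W=(\pi_*\mathcal{O}_X)^{\tau}$ is $(a,c)\mapsto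 a+c+\tau^*(c)$. The product of $\pi_*\mathcal{O}_X$ restricts to $U_1\otimes U_1\to U_2$, and $m_{11}\colon U_1\otimes U_1\to U_1$ denotes this map followed by $\tau^*\colon U_2\to U_1$. For the degree 3 cover $f$, $f_*\mathcal{O}_W=\mathcal{O}_Y\oplus E$ with $E$ the Tschirnhausen module (elements whose minimal cubic polynomial over $\mathcal{O}_Y$ has no square term), and $\phi_2\colon E\otimes E\to E$ is the product of $f_*\mathcal{O}_W$ followed by the projection onto $E$. *)

theory Defs
  imports
    "HOL-Analysis.Abstract_Topology"
    "HOL-Library.Extended_Nat"
    "HOL-Computational_Algebra.Polynomial"
    "HOL-Algebra.Ring_Divisibility"
    "HOL-Algebra.Free_Abelian_Groups"
begin

section \<open>Spaces with functions\<close>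

text \<open>
  Varieties over the complex numbers are taken in the sense of Serre: a topological space of
  closed points together with a sheaf of complex-valued functions, locally isomorphic to affine
  algebraic sets. A section over an open set \<open>U\<close> is an extensional function on \<open>U\<close> (value
  \<open>undefined\<close> outside \<open>U\<close>), so that equality of sections is equality of functions.
\<close>

record 'a funspace =
  ftop :: "'a topology"
  sect :: "'a set \<Rightarrow> ('a \<Rightarrow> complex) set"

definition space_with_functions :: "'a funspace \<Rightarrow> bool" where
  "space_with_functions X \<longleftrightarrow>
    (\<forall>U. openin (ftop X) U \<longrightarrow>
       sect X U \<subseteq> extensional U \<and>
       (\<forall>c. (\<lambda>x\<in>U. c) \<in> sect X U) \<and>
       (\<forall>g\<in>sect X U. \<forall>h\<in>sect X U.
          (\<lambda>x\<in>U. g x + h x) \<in> sect X U \<and> (\<lambda>x\<in>U. g x * h x) \<in> sect X U) \<and>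
       (\<forall>V g. openin (ftop X) V \<and> V \<subseteq> U \<and> g \<in> sect X U \<longrightarrow> restrict g V \<in> sect X V) \<and>
       (\<forall>g\<in>sect X U. openin (ftop X) {x\<in>U. g x \<noteq> 0} \<and>
          (\<lambda>x\<in>{x\<in>U. g x \<noteq> 0}. 1 / g x) \<in> sect X {x\<in>U. g x \<noteq> 0})) \<and>
    (\<forall>\<U> g. (\<forall>U\<in>\<U>. openin (ftop X) U \<and> restrict g U \<in> sect X U) \<and> g \<in> extensional (\<Union>\<U>)
       \<longrightarrow> g \<in> sect X (\<Union>\<U>))"

definition open_subspace :: "'a funspace \<Rightarrow> 'a set \<Rightarrow> 'a funspace" where
  "open_subspace X U = \<lparr>ftop = subtopology (ftop X) U, sect = sect X\<rparr>"

definition preim :: "'a funspace \<Rightarrow> ('a \<Rightarrow> 'b) \<Rightarrow> 'b set \<Rightarrow> 'a set" where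
  "preim X \<phi> V = {x \<in> topspace (ftop X). \<phi> x \<in> V}"

definition pullback :: "'a funspace \<Rightarrow> ('a \<Rightarrow> 'b) \<Rightarrow> 'b set \<Rightarrow> ('b \<Rightarrow> complex) \<Rightarrow> 'a \<Rightarrow> complex" where
  "pullback X \<phi> V g = (\<lambda>x\<in>preim X \<phi> V. g (\<phi> x))"

definition morphism :: "'a funspace \<Rightarrow> 'b funspace \<Rightarrow> ('a \<Rightarrow> 'b) \<Rightarrow> bool" where
  "morphism X Y \<phi> \<longleftrightarrow> continuous_map (ftop X) (ftop Y) \<phi> \<and>
    (\<forall>V. openin (ftop Y) V \<longrightarrow> (\<forall>g\<in>sect Y V. pullback X \<phi> V g \<in> sect X (preim X \<phi> V)))"

definition isomorphism :: "'a funspace \<Rightarrow> 'b funspace \<Rightarrow> ('a \<Rightarrow> 'b) \<Rightarrow> bool" where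
  "isomorphism X Y \<phi> \<longleftrightarrow> morphism X Y \<phi> \<and>
    (\<exists>\<psi>. morphism Y X \<psi> \<and> (\<forall>x\<in>topspace (ftop X). \<psi> (\<phi> x) = x) \<and>
         (\<forall>y\<in>topspace (ftop Y). \<phi> (\<psi> y) = y))"

section \<open>Affine algebraic sets and varieties\<close>

text \<open>Affine \<open>n\<close>-space is the set of functions \<open>{..<n} \<rightarrow>\<^sub>E UNIV\<close>.\<close>

inductive_set poly_fun :: "nat \<Rightarrow> ((nat \<Rightarrow> complex) \<Rightarrow> complex) set" for n where
  const: "(\<lambda>_. c) \<in> poly_fun n"
| coord: "i < n \<Longrightarrow> (\<lambda>x. x i) \<in> poly_fun n"
| add: "p \<in> poly_fun n \<Longrightarrow> q \<in> poly_fun n \<Longrightarrow> (\<lambda>x. p x + q x) \<in> poly_fun n"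
| mult: "p \<in> poly_fun n \<Longrightarrow> q \<in> poly_fun n \<Longrightarrow> (\<lambda>x. p x * q x) \<in> poly_fun n"

definition zariski :: "nat \<Rightarrow> (nat \<Rightarrow> complex) topology" where
  "zariski n = topology_generated_by {{x \<in> {..<n} \<rightarrow>\<^sub>E UNIV. p x \<noteq> 0} | p. p \<in> poly_fun n}"

definition affine_algebraic :: "nat \<Rightarrow> (nat \<Rightarrow> complex) set \<Rightarrow> (nat \<Rightarrow> complex) funspace" where
  "affine_algebraic n Z =
    \<lparr>ftop = subtopology (zariski n) Z,
     sect = (\<lambda>U. {g \<in> extensional U. \<forall>x\<in>U. \<exists>V p q.
        openin (subtopology (zariski n) Z) V \<and> x \<in> V \<and> V \<subseteq> U \<and>
        p \<in> poly_fun n \<and> q \<in> poly_fun n \<and> (\<forall>y\<in>V. q y \<noteq> 0 \<and> g y = p y / q y)})\<rparr>"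

definition affine_space :: "'a funspace \<Rightarrow> bool" where
  "affine_space X \<longleftrightarrow>
    (\<exists>n Z \<phi>. closedin (zariski n) Z \<and> isomorphism X (affine_algebraic n Z) \<phi>)"

definition affine_open :: "'a funspace \<Rightarrow> 'a set \<Rightarrow> bool" where
  "affine_open X U \<longleftrightarrow> openin (ftop X) U \<and> affine_space (open_subspace X U)"

definition irreducible_space :: "'a topology \<Rightarrow> bool" where
  "irreducible_space T \<longleftrightarrow> topspace T \<noteq> {} \<and>
    (\<forall>A B. closedin T A \<and> closedin T B \<and> A \<union> B = topspace T \<longrightarrow> A = topspace T \<or> B = topspace T)"

text \<open>Separation axiom: two morphisms from an affine algebraic set agree on a closed set.\<close>

definition separated :: "'a funspace \<Rightarrow> bool" where
  "separated X \<longleftrightarrow>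
    (\<forall>n Z \<phi> \<psi>. closedin (zariski n) Z \<and>
       morphism (affine_algebraic n Z) X \<phi> \<and> morphism (affine_algebraic n Z) X \<psi>
       \<longrightarrow> closedin (zariski n) {z \<in> Z. \<phi> z = \<psi> z})"

definition variety :: "'a funspace \<Rightarrow> bool" where
  "variety X \<longleftrightarrow> space_with_functions X \<and> irreducible_space (ftop X) \<and> separated X \<and>
    (\<exists>\<U>. finite \<U> \<and> (\<forall>U\<in>\<U>. affine_open X U) \<and> \<Union>\<U> = topspace (ftop X))"

section \<open>Local rings, smoothness and normality\<close>

type_synonym 'a germs = "('a set \<times> ('a \<Rightarrow> complex)) set"

definition germ :: "'a funspace \<Rightarrow> 'a \<Rightarrow> 'a set \<Rightarrow> ('a \<Rightarrow> complex) \<Rightarrow> 'a germs" where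
  "germ X x U g = {(V, h). openin (ftop X) V \<and> x \<in> V \<and> h \<in> sect X V \<and>
     (\<exists>W. openin (ftop X) W \<and> x \<in> W \<and> W \<subseteq> U \<inter> V \<and> (\<forall>y\<in>W. g y = h y))}"

text \<open>The union below is over representatives of two germs; all of them give the same germ.\<close>

definition germ_lift :: "'a funspace \<Rightarrow> 'a \<Rightarrow> (complex \<Rightarrow> complex \<Rightarrow> complex) \<Rightarrow>
    'a germs \<Rightarrow> 'a germs \<Rightarrow> 'a germs" where
  "germ_lift X x op s t =
    (\<Union>(U, g)\<in>s. \<Union>(V, h)\<in>t. germ X x (U \<inter> V) (\<lambda>y\<in>U \<inter> V. op (g y) (h y)))"

definition stalk :: "'a funspace \<Rightarrow> 'a \<Rightarrow> 'a germs ring" where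
  "stalk X x =
    \<lparr>carrier = {germ X x U g | U g. openin (ftop X) U \<and> x \<in> U \<and> g \<in> sect X U},
     mult = germ_lift X x (*),
     one = germ X x (topspace (ftop X)) (\<lambda>y\<in>topspace (ftop X). 1),
     ring.zero = germ X x (topspace (ftop X)) (\<lambda>y\<in>topspace (ftop X). 0),
     ring.add = germ_lift X x (+)\<rparr>"

definition stalk_map :: "'a funspace \<Rightarrow> ('a \<Rightarrow> 'b) \<Rightarrow> 'a \<Rightarrow> 'b germs \<Rightarrow> 'a germs" where
  "stalk_map X \<phi> x s = (\<Union>(V, g)\<in>s. germ X x (preim X \<phi> V) (pullback X \<phi> V g))"

definition krull_dim :: "('r, 'm) ring_scheme \<Rightarrow> enat" where
  "krull_dim R =
    (SUP n\<in>{n. \<exists>P. (\<forall>i\<le>n. primeideal (P i) R) \<and> (\<forall>i<n. P i \<subset> P (Suc i))}. enat n)"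

definition regular_local_ring :: "('r, 'm) ring_scheme \<Rightarrow> bool" where
  "regular_local_ring R \<longleftrightarrow> cring R \<and> noetherian_ring R \<and>
    (\<exists>M. maximalideal M R \<and> (\<forall>M'. maximalideal M' R \<longrightarrow> M' = M) \<and>
         (\<exists>S\<subseteq>carrier R. finite S \<and> enat (card S) = krull_dim R \<and> M = genideal R S))"

definition smooth_variety :: "'a funspace \<Rightarrow> bool" where
  "smooth_variety X \<longleftrightarrow> variety X \<and> (\<forall>x\<in>topspace (ftop X). regular_local_ring (stalk X x))"

text \<open>
  Elements \<open>a / b\<close> of the fraction field that are integral over \<open>R\<close> lie in \<open>R\<close>, with the
  equation of integral dependence multiplied by \<open>b ^ n\<close>.
\<close>

definition integrally_closed_domain :: "('r, 'm) ring_scheme \<Rightarrow> bool" where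
  "integrally_closed_domain R \<longleftrightarrow> domain R \<and>
    (\<forall>a\<in>carrier R. \<forall>b\<in>carrier R - {\<zero>\<^bsub>R\<^esub>}. \<forall>n>0. \<forall>c\<in>{..<n::nat} \<rightarrow> carrier R.
       a [^]\<^bsub>R\<^esub> n \<oplus>\<^bsub>R\<^esub>
         (\<Oplus>\<^bsub>R\<^esub>i\<in>{..<n}. c i \<otimes>\<^bsub>R\<^esub> (a [^]\<^bsub>R\<^esub> i \<otimes>\<^bsub>R\<^esub> b [^]\<^bsub>R\<^esub> (n - i))) = \<zero>\<^bsub>R\<^esub>
       \<longrightarrow> (\<exists>r\<in>carrier R. a = r \<otimes>\<^bsub>R\<^esub> b))"

definition normal_variety :: "'a funspace \<Rightarrow> bool" where
  "normal_variety X \<longleftrightarrow> variety X \<and>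
    (\<forall>x\<in>topspace (ftop X). integrally_closed_domain (stalk X x))"

section \<open>Flatness and finiteness\<close>

definition tensor_relations ::
    "('r, 'k) ring_scheme \<Rightarrow> ('r, 'n, 'k1) module_scheme \<Rightarrow> ('r, 'm, 'k2) module_scheme
      \<Rightarrow> ('n \<times> 'm \<Rightarrow>\<^sub>0 int) set" where
  "tensor_relations R N M =
    generate (free_Abelian_group (carrier N \<times> carrier M))
      ({frag_of (x \<oplus>\<^bsub>N\<^esub> y, m) - frag_of (x, m) - frag_of (y, m) | x y m.
          x \<in> carrier N \<and> y \<in> carrier N \<and> m \<in> carrier M} \<union>
       {frag_of (x, m \<oplus>\<^bsub>M\<^esub> m') - frag_of (x, m) - frag_of (x, m') | x m m'.
          x \<in> carrier N \<and> m \<in> carrier M \<and> m' \<in> carrier M} \<union>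
       {frag_of (r \<odot>\<^bsub>N\<^esub> x, m) - frag_of (x, r \<odot>\<^bsub>M\<^esub> m) | r x m.
          r \<in> carrier R \<and> x \<in> carrier N \<and> m \<in> carrier M})"

definition tensor_product ::
    "('r, 'k) ring_scheme \<Rightarrow> ('r, 'n, 'k1) module_scheme \<Rightarrow> ('r, 'm, 'k2) module_scheme
      \<Rightarrow> ('n \<times> 'm \<Rightarrow>\<^sub>0 int) set monoid" where
  "tensor_product R N M =
    free_Abelian_group (carrier N \<times> carrier M) Mod tensor_relations R N M"

text \<open>The map of tensor products \<open>u \<otimes> id\<close>, into \<open>N \<otimes> M\<close>, for \<open>u\<close> a homomorphism into \<open>N\<close>.\<close>

definition tensor_map ::
    "('r, 'k) ring_scheme \<Rightarrow> ('r, 'n, 'k1) module_scheme \<Rightarrow> ('r, 'm, 'k2) module_scheme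
      \<Rightarrow> ('n1 \<Rightarrow> 'n) \<Rightarrow> ('n1 \<times> 'm \<Rightarrow>\<^sub>0 int) set \<Rightarrow> ('n \<times> 'm \<Rightarrow>\<^sub>0 int) set" where
  "tensor_map R N M u C =
    (\<Union>z\<in>C. tensor_relations R N M #>\<^bsub>free_Abelian_group (carrier N \<times> carrier M)\<^esub>
               frag_extend (\<lambda>(x, m). frag_of (u x, m)) z)"

definition module_hom ::
    "('r, 'k) ring_scheme \<Rightarrow> ('r, 'n, 'k1) module_scheme \<Rightarrow> ('r, 'm, 'k2) module_scheme
      \<Rightarrow> ('n \<Rightarrow> 'm) \<Rightarrow> bool" where
  "module_hom R N M u \<longleftrightarrow> u \<in> carrier N \<rightarrow> carrier M \<and>
    (\<forall>x\<in>carrier N. \<forall>y\<in>carrier N. u (x \<oplus>\<^bsub>N\<^esub> y) = u x \<oplus>\<^bsub>M\<^esub> u y) \<and>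
    (\<forall>r\<in>carrier R. \<forall>x\<in>carrier N. u (r \<odot>\<^bsub>N\<^esub> x) = r \<odot>\<^bsub>M\<^esub> u x)"

text \<open>
  Tensoring with \<open>M\<close> preserves injective homomorphisms. The test modules are carried by the type
  \<open>(nat \<Rightarrow> 'r) set\<close>, which contains a copy of every finitely generated \<open>R\<close>-module (a quotient of
  some \<open>R ^ n\<close>); since tensor products commute with direct limits, no further modules are needed.
\<close>

definition flat_module :: "('r, 'k) ring_scheme \<Rightarrow> ('r, 'm, 'k1) module_scheme \<Rightarrow> bool" where
  "flat_module R M \<longleftrightarrow> Module.module R M \<and>
    (\<forall>(N' :: ('r, (nat \<Rightarrow> 'r) set) module) (N :: ('r, (nat \<Rightarrow> 'r) set) module) u.
       Module.module R N' \<and> Module.module R N \<and> module_hom R N' N u \<and> inj_on u (carrier N')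
       \<longrightarrow> inj_on (tensor_map R N M u) (carrier (tensor_product R N' M)))"

definition stalk_module :: "'a funspace \<Rightarrow> ('a \<Rightarrow> 'b) \<Rightarrow> 'a \<Rightarrow> ('b germs, 'a germs) module" where
  "stalk_module X \<phi> x = ring.extend (stalk X x)
     \<lparr>smult = (\<lambda>r m. stalk_map X \<phi> x r \<otimes>\<^bsub>stalk X x\<^esub> m)\<rparr>"

definition flat_morphism :: "'a funspace \<Rightarrow> 'b funspace \<Rightarrow> ('a \<Rightarrow> 'b) \<Rightarrow> bool" where
  "flat_morphism X Y \<phi> \<longleftrightarrow> morphism X Y \<phi> \<and>
    (\<forall>x\<in>topspace (ftop X). flat_module (stalk Y (\<phi> x)) (stalk_module X \<phi> x))"

definition finite_morphism :: "'a funspace \<Rightarrow> 'b funspace \<Rightarrow> ('a \<Rightarrow> 'b) \<Rightarrow> bool" where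
  "finite_morphism X Y \<phi> \<longleftrightarrow> morphism X Y \<phi> \<and>
    (\<exists>\<V>. \<Union>\<V> = topspace (ftop Y) \<and>
      (\<forall>V\<in>\<V>. affine_open Y V \<and> affine_open X (preim X \<phi> V) \<and>
        (\<exists>B\<subseteq>sect X (preim X \<phi> V). finite B \<and>
          (\<forall>h\<in>sect X (preim X \<phi> V). \<exists>a. (\<forall>b\<in>B. a b \<in> sect Y V) \<and>
             (\<forall>x\<in>preim X \<phi> V. h x = (\<Sum>b\<in>B. a b (\<phi> x) * b x))))))"

section \<open>Quotients and dihedral covers\<close>

definition orbit_of :: "('a \<Rightarrow> 'a) set \<Rightarrow> 'a \<Rightarrow> 'a set" where
  "orbit_of G x = (\<lambda>g. g x) ` G"

definition orbit_topology :: "'a topology \<Rightarrow> ('a \<Rightarrow> 'a) set \<Rightarrow> 'a set topology" where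
  "orbit_topology T G = topology (\<lambda>\<U>. \<U> \<subseteq> orbit_of G ` topspace T \<and>
     openin T {x \<in> topspace T. orbit_of G x \<in> \<U>})"

lemma openin_orbit_topology:
  "openin (orbit_topology T G) \<U> \<longleftrightarrow>
     \<U> \<subseteq> orbit_of G ` topspace T \<and> openin T {x \<in> topspace T. orbit_of G x \<in> \<U>}"
proof -
  have "istopology (\<lambda>\<U>. \<U> \<subseteq> orbit_of G ` topspace T \<and>
     openin T {x \<in> topspace T. orbit_of G x \<in> \<U>})" (is "istopology ?L")
    unfolding istopology_def
  proof (intro conjI allI impI)
    fix S S' assume S: "?L S" and S': "?L S'"
    have "{x \<in> topspace T. orbit_of G x \<in> S \<inter> S'} =
      {x \<in> topspace T. orbit_of G x \<in> S} \<inter> {x \<in> topspace T. orbit_of G x \<in> S'}" by auto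
    with S S' show "openin T {x \<in> topspace T. orbit_of G x \<in> S \<inter> S'}" by auto
    from S show "S \<inter> S' \<subseteq> orbit_of G ` topspace T" by auto
  next
    fix \<K> assume K: "\<forall>K\<in>\<K>. ?L K"
    have "{x \<in> topspace T. orbit_of G x \<in> \<Union>\<K>} =
      (\<Union>K\<in>\<K>. {x \<in> topspace T. orbit_of G x \<in> K})" by auto
    with K show "openin T {x \<in> topspace T. orbit_of G x \<in> \<Union>\<K>}" by auto
    from K show "\<Union>\<K> \<subseteq> orbit_of G ` topspace T" by blast
  qed
  then show ?thesis by (simp add: orbit_topology_def)
qed

text \<open>
  The quotient \<open>X / G\<close>: its points are the orbits, and a function on an open set of orbits is
  regular iff its pullback to \<open>X\<close> is, so that the sections are the \<open>G\<close>-invariant sections of \<open>X\<close>.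
\<close>

definition quotient_space :: "'a funspace \<Rightarrow> ('a \<Rightarrow> 'a) set \<Rightarrow> 'a set funspace" where
  "quotient_space X G =
    \<lparr>ftop = orbit_topology (ftop X) G,
     sect = (\<lambda>\<U>. {g \<in> extensional \<U>.
        pullback X (orbit_of G) \<U> g \<in> sect X (preim X (orbit_of G) \<U>)})\<rparr>"

definition induced_map :: "('a \<Rightarrow> 'b) \<Rightarrow> 'a set \<Rightarrow> 'b" where
  "induced_map \<phi> orb = the_elem (\<phi> ` orb)"

definition D3_maps :: "('a \<Rightarrow> 'a) \<Rightarrow> ('a \<Rightarrow> 'a) \<Rightarrow> ('a \<Rightarrow> 'a) set" where
  "D3_maps \<sigma> \<tau> = {(\<sigma> ^^ i) \<circ> (\<tau> ^^ j) | i j. i < 3 \<and> j < 2}"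

definition D3_action :: "'a funspace \<Rightarrow> ('a \<Rightarrow> 'a) \<Rightarrow> ('a \<Rightarrow> 'a) \<Rightarrow> bool" where
  "D3_action X \<sigma> \<tau> \<longleftrightarrow> isomorphism X X \<sigma> \<and> isomorphism X X \<tau> \<and>
    (\<forall>x\<in>topspace (ftop X). (\<sigma> ^^ 3) x = x \<and> (\<tau> ^^ 2) x = x \<and> ((\<sigma> \<circ> \<tau>) ^^ 2) x = x)"

text \<open>Every element of the dihedral group is \<open>\<sigma>\<^sup>i \<tau>\<^sup>j\<close> for unique \<open>i < 3\<close> and \<open>j < 2\<close>.\<close>

definition D3_effective :: "'a funspace \<Rightarrow> ('a \<Rightarrow> 'a) \<Rightarrow> ('a \<Rightarrow> 'a) \<Rightarrow> bool" where
  "D3_effective X \<sigma> \<tau> \<longleftrightarrow>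
    (\<forall>i<3. \<forall>j<2. (\<forall>x\<in>topspace (ftop X). (\<sigma> ^^ i) ((\<tau> ^^ j) x) = x) \<longrightarrow> i = 0 \<and> j = 0)"

definition D3_cover ::
    "'a funspace \<Rightarrow> 'b funspace \<Rightarrow> ('a \<Rightarrow> 'a) \<Rightarrow> ('a \<Rightarrow> 'a) \<Rightarrow> ('a \<Rightarrow> 'b) \<Rightarrow> bool" where
  "D3_cover X Y \<sigma> \<tau> \<pi> \<longleftrightarrow> variety X \<and> variety Y \<and> finite_morphism X Y \<pi> \<and>
    D3_action X \<sigma> \<tau> \<and> D3_effective X \<sigma> \<tau> \<and>
    (\<forall>x\<in>topspace (ftop X). \<pi> (\<sigma> x) = \<pi> x \<and> \<pi> (\<tau> x) = \<pi> x) \<and>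
    isomorphism (quotient_space X (D3_maps \<sigma> \<tau>)) Y (induced_map \<pi>)"

text \<open>
  The sheaves \<open>U\<^sub>1\<close>, \<open>U\<^sub>2\<close> and the maps between them are given by their sections over an open
  set \<open>V\<close> of \<open>Y\<close>; maps out of a tensor product are given by the corresponding bilinear maps.
\<close>

definition U_sect ::
    "'a funspace \<Rightarrow> ('a \<Rightarrow> 'a) \<Rightarrow> ('a \<Rightarrow> 'b) \<Rightarrow> nat \<Rightarrow> 'b set \<Rightarrow> ('a \<Rightarrow> complex) set" where
  "U_sect X \<sigma> \<pi> j V = {h \<in> sect X (preim X \<pi> V).
     \<forall>x\<in>preim X \<pi> V. h (\<sigma> x) = exp (2 * of_real pi * \<i> * of_nat j / 3) * h x}"

definition m11 :: "'a funspace \<Rightarrow> ('a \<Rightarrow> 'a) \<Rightarrow> ('a \<Rightarrow> 'b) \<Rightarrow> 'b set \<Rightarrow>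
    ('a \<Rightarrow> complex) \<Rightarrow> ('a \<Rightarrow> complex) \<Rightarrow> 'a \<Rightarrow> complex" where
  "m11 X \<tau> \<pi> V c d = pullback X \<tau> (preim X \<pi> V) (\<lambda>x\<in>preim X \<pi> V. c x * d x)"

text \<open>
  The section of \<open>X / \<langle>\<tau>\<rangle>\<close> whose pullback to \<open>X\<close> is \<open>a + c + \<tau>\<^sup>*(c)\<close>.
\<close>

definition identification :: "'a funspace \<Rightarrow> ('a \<Rightarrow> 'a) \<Rightarrow> ('a \<Rightarrow> 'b) \<Rightarrow> 'b set \<Rightarrow>
    ('b \<Rightarrow> complex) \<Rightarrow> ('a \<Rightarrow> complex) \<Rightarrow> 'a set \<Rightarrow> complex" where
  "identification X \<tau> \<pi> V a c =
    (\<lambda>w\<in>preim (quotient_space X {id, \<tau>}) (induced_map \<pi>) V.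
       the_elem ((\<lambda>x. a (\<pi> x) + c x + c (\<tau> x)) ` w))"

section \<open>The Tschirnhausen module of a triple cover\<close>

text \<open>
  A polynomial over the ring \<open>sect Y V\<close> is represented by the family, indexed by the points of
  \<open>V\<close>, of its values in the complex polynomials.
\<close>

definition monic_over :: "'b funspace \<Rightarrow> 'b set \<Rightarrow> nat \<Rightarrow> ('b \<Rightarrow> complex poly) \<Rightarrow> bool" where
  "monic_over Y V n p \<longleftrightarrow>
    (\<forall>i. (\<lambda>y\<in>V. Polynomial.coeff (p y) i) \<in> sect Y V) \<and>
    (\<forall>y\<in>V. Polynomial.degree (p y) = n \<and> Polynomial.coeff (p y) n = 1)"

definition annihilates :: "'w funspace \<Rightarrow> ('w \<Rightarrow> 'b) \<Rightarrow> 'b set \<Rightarrow>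
    ('b \<Rightarrow> complex poly) \<Rightarrow> ('w \<Rightarrow> complex) \<Rightarrow> bool" where
  "annihilates W f V p h \<longleftrightarrow> (\<forall>w\<in>preim W f V. poly (p (f w)) (h w) = 0)"

definition minimal_poly :: "'w funspace \<Rightarrow> 'b funspace \<Rightarrow> ('w \<Rightarrow> 'b) \<Rightarrow> 'b set \<Rightarrow>
    ('w \<Rightarrow> complex) \<Rightarrow> nat \<Rightarrow> ('b \<Rightarrow> complex poly) \<Rightarrow> bool" where
  "minimal_poly W Y f V h n m \<longleftrightarrow> 0 < n \<and> monic_over Y V n m \<and> annihilates W f V m h \<and>
    (\<forall>k q. 0 < k \<and> k < n \<longrightarrow> \<not> (monic_over Y V k q \<and> annihilates W f V q h))"

text \<open>
  For \<open>h\<close> not in \<open>O\<^sub>Y\<close> the minimal polynomial of \<open>h\<close> is itself cubic, since the cover has degree 3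
  and hence no intermediate fields. For \<open>h\<close> a section \<open>a\<close> of \<open>O\<^sub>Y\<close> the minimal polynomial is
  \<open>z - a\<close>, and the cubic polynomial attached to \<open>h\<close> is its power \<open>(z - a)\<^sup>3\<close>.
\<close>

definition minimal_cubic :: "'w funspace \<Rightarrow> 'b funspace \<Rightarrow> ('w \<Rightarrow> 'b) \<Rightarrow> 'b set \<Rightarrow>
    ('w \<Rightarrow> complex) \<Rightarrow> ('b \<Rightarrow> complex poly) \<Rightarrow> bool" where
  "minimal_cubic W Y f V h p \<longleftrightarrow> monic_over Y V 3 p \<and>
    (\<exists>n m k. minimal_poly W Y f V h n m \<and> (\<forall>y\<in>V. p y = m y ^ k))"

definition tschirnhausen :: "'w funspace \<Rightarrow> 'b funspace \<Rightarrow> ('w \<Rightarrow> 'b) \<Rightarrow> 'b set \<Rightarrow>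
    ('w \<Rightarrow> complex) set" where
  "tschirnhausen W Y f V = {h \<in> sect W (preim W f V).
     \<exists>p. minimal_cubic W Y f V h p \<and> (\<forall>y\<in>V. Polynomial.coeff (p y) 2 = 0)}"

text \<open>
  The product of two sections of \<open>E\<close>, followed by the projection of \<open>O\<^sub>Y \<oplus> E\<close> onto \<open>E\<close>.
\<close>

definition phi2 :: "'w funspace \<Rightarrow> 'b funspace \<Rightarrow> ('w \<Rightarrow> 'b) \<Rightarrow> 'b set \<Rightarrow>
    ('w \<Rightarrow> complex) \<Rightarrow> ('w \<Rightarrow> complex) \<Rightarrow> 'w \<Rightarrow> complex" where
  "phi2 W Y f V e e' = (THE e''. e'' \<in> tschirnhausen W Y f V \<and>
     (\<exists>a\<in>sect Y V. \<forall>w\<in>preim W f V. e w * e' w = a (f w) + e'' w))"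

end

theory Submission
  imports Defs
begin

text \<open>
  The proof is Galois theory over an open set \<open>V\<close> of \<open>Y\<close>, carried out with functions on its
  preimage in \<open>X\<close>. Write \<open>\<omega>\<close> for the primitive cube root of unity \<open>exp (2 \<pi> i / 3)\<close>.

  A section \<open>h\<close> of \<open>W = X / \<langle>\<tau>\<rangle>\<close> is a \<open>\<tau>\<close>-invariant regular function \<open>H\<close> upstairs. Averaging
  over \<open>\<langle>\<sigma>\<rangle>\<close> with the characters \<open>1\<close>, \<open>\<omega>\<close>, \<open>\<omega>\<^sup>2\<close> (Lagrange resolvents) writes \<open>H\<close> as
  \<open>a + c + c'\<close> with \<open>a\<close> invariant under \<open>\<sigma>\<close>, \<open>c\<close> in \<open>U\<^sub>1\<close> and \<open>c'\<close> in \<open>U\<^sub>2\<close>. Since \<open>\<tau>\<close> inverts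
  \<open>\<sigma>\<close>, the invariance of \<open>H\<close> under \<open>\<tau>\<close> forces \<open>c' = \<tau>\<^sup>*c\<close> and \<open>\<tau>\<^sup>*a = a\<close>; and a function
  invariant under the dihedral group descends to \<open>Y = X / D\<^sub>3\<close> (\<open>descent\<close>). The resolvents
  recover \<open>a\<close> and \<open>c\<close> from \<open>H\<close>, so the identification is bijective (\<open>bij_betw_ident\<close>).

  The conjugates of \<open>H = c + \<tau>\<^sup>*c\<close> are \<open>\<omega>\<^sup>i c + \<omega>\<^sup>-\<^sup>i \<tau>\<^sup>*c\<close>, the roots of the Cardano cubic
  \<open>z\<^sup>3 - 3 (c \<tau>\<^sup>*c) z - (c\<^sup>3 + (\<tau>\<^sup>*c)\<^sup>3)\<close>. Its coefficients are invariant, hence sections of \<open>Y\<close>,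
  and it has no square term. That no polynomial of lower degree annihilates \<open>H\<close> when
  \<open>c \<noteq> 0\<close> comes from the irreducibility of \<open>X\<close>: a polynomial over \<open>V\<close> vanishing at \<open>H\<close> vanishes
  at all its conjugates, so in degree less than 3 two of them agree at every point. The product of
  the three differences is then zero, one factor is zero (\<open>conjugates_coincide\<close>), \<open>H\<close> is
  \<open>\<sigma>\<close>-invariant, and its resolvent \<open>c\<close> vanishes. Conversely, a monic cubic annihilating \<open>H\<close> has,
  wherever the conjugates are distinct, minus the trace \<open>3 a\<close> of \<open>H\<close> as its coefficient of \<open>z\<^sup>2\<close>.
  If this coefficient is zero, the same irreducibility argument gives \<open>a = 0\<close> or \<open>c = 0\<close>; the
  second case is settled by the definition of the cubic of an element of \<open>O\<^sub>Y\<close>, the cube of its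
  linear minimal polynomial. Hence \<open>tschirnhausen_eq\<close>.

  Finally, in \<open>(c + \<tau>\<^sup>*c) (d + \<tau>\<^sup>*d)\<close> the mixed terms are invariant, and \<open>c d\<close>, of character
  \<open>\<omega>\<^sup>2\<close>, is \<open>\<tau>\<^sup>*\<close> of \<open>m\<^sub>1\<^sub>1(c, d) = \<tau>\<^sup>*(c d)\<close>. By uniqueness of the decomposition the component
  in \<open>E\<close> is the image of \<open>m\<^sub>1\<^sub>1(c, d)\<close> (\<open>phi2_ident\<close>).
\<close>

section \<open>Cube roots of unity and cubic polynomials\<close>

definition \<omega> :: complex where
  "\<omega> = exp (2 * of_real pi * \<i> / 3)"

lemma omega_cube: "\<omega> ^ 3 = 1"
proof -
  have "\<omega> ^ 3 = exp (of_nat 3 * (2 * of_real pi * \<i> / 3))"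
    unfolding \<omega>_def by (rule exp_of_nat_mult [symmetric])
  also have "\<dots> = exp (2 * of_real pi * \<i>)" by (rule arg_cong[of _ _ exp]) simp
  finally show ?thesis by (simp only: exp_two_pi_i)
qed

lemma omega_neq_1: "\<omega> \<noteq> 1"
proof -
  have "\<omega> = cis (2 * pi / 3)"
    by (simp add: \<omega>_def cis_conv_exp mult_ac)
  then have "Im \<omega> = sin (2 * pi / 3)" by (metis cis.sel(2))
  then have "Im \<omega> = sqrt 3 / 2" using sin_120 by metis
  then show ?thesis by auto
qed

lemma omega_square: "\<omega>\<^sup>2 = - 1 - \<omega>"
proof -
  have "(\<omega> - 1) * (\<omega>\<^sup>2 + \<omega> + 1) = 0"
    using omega_cube by (simp add: algebra_simps power2_eq_square power3_eq_cube)
  with omega_neq_1 have "\<omega>\<^sup>2 + \<omega> + 1 = 0" by simp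
  then have "\<omega>\<^sup>2 = - (\<omega> + 1)" by (simp only: eq_neg_iff_add_eq_0 add.assoc)
  then show ?thesis by simp
qed

text \<open>
  Rewriting from left to right brings every polynomial in \<open>\<omega>\<close> to the form \<open>u + \<omega> v\<close>. The second
  equation applies inside products nested to the right.
\<close>

lemma omega_mult_omega: "\<omega> * \<omega> = - 1 - \<omega>" "\<omega> * (\<omega> * z) = - z - \<omega> * z"
proof -
  show "\<omega> * \<omega> = - 1 - \<omega>" using omega_square by (simp only: power2_eq_square)
  then have "\<omega> * \<omega> * z = (- 1 - \<omega>) * z" by (simp only:)
  then show "\<omega> * (\<omega> * z) = - z - \<omega> * z" by (simp add: left_diff_distrib mult.assoc)
qed

lemma few_roots_coincide:
  fixes q :: "complex poly"
  assumes "q \<noteq> 0" "Polynomial.degree q < 3" "poly q r = 0" "poly q s = 0" "poly q t = 0"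
  shows "r = s \<or> s = t \<or> r = t"
proof (rule ccontr)
  assume "\<not> ?thesis"
  then have "3 = card {r, s, t}" by simp
  also have "card {r, s, t} \<le> card {z. poly q z = 0}"
    using assms by (intro card_mono poly_roots_finite) auto
  also have "card {z. poly q z = 0} \<le> Polynomial.degree q" using assms(1) by (rule card_poly_roots_bound)
  finally show False using assms(2) by simp
qed

lemma cubic_sum_of_roots:
  fixes p :: "complex poly"
  assumes "Polynomial.degree p = 3" "Polynomial.coeff p 3 = 1" "poly p r = 0" "poly p s = 0" "poly p t = 0"
    and "r \<noteq> s" "s \<noteq> t" "r \<noteq> t"
  shows "Polynomial.coeff p 2 = - (r + s + t)"
proof -
  have "p = [:-r, 1:] * [:-s, 1:] * [:-t, 1:]"
    by (rule poly_eqI_degree_lead_coeff[where n = 3 and A = "{r, s, t}"])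
      (use assms in \<open>auto simp: numeral_3_eq_3 algebra_simps\<close>)
  then show ?thesis by (simp add: numeral_2_eq_2 algebra_simps)
qed

text \<open>
  The cubic solved by Cardano's substitution \<open>z = u + v\<close>.
\<close>

lemma cardano_cubic_root:
  "poly [:- (u ^ 3 + v ^ 3), - 3 * (u * v), 0, 1:] (u + v) = (0 :: complex)"
  by (simp add: algebra_simps power3_eq_cube)

section \<open>The dihedral action over an open set\<close>

lemma topspace_orbit_topology: "topspace (orbit_topology T G) = orbit_of G ` topspace T"
proof -
  have "{x \<in> topspace T. orbit_of G x \<in> orbit_of G ` topspace T} = topspace T" by auto
  then have "openin (orbit_topology T G) (orbit_of G ` topspace T)"
    by (simp add: openin_orbit_topology)
  then show ?thesis
    by (metis openin_orbit_topology openin_subset openin_topspace subset_antisym)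
qed

text \<open>
  The open set \<open>V\<close> is fixed because every assertion of the theorem concerns one open set at a time.
\<close>

locale D3_cover_over_open =
  fixes X :: "'a funspace" and Y :: "'b funspace"
    and \<sigma> \<tau> :: "'a \<Rightarrow> 'a" and \<pi> :: "'a \<Rightarrow> 'b" and V :: "'b set"
  assumes cover: "D3_cover X Y \<sigma> \<tau> \<pi>" and open_V: "openin (ftop Y) V"
begin

abbreviation XV :: "'a set" where "XV \<equiv> preim X \<pi> V"

text \<open>
  Regularity is required of arbitrary functions through their restriction, so that sums, products
  and composites with \<open>\<sigma>\<close>, \<open>\<tau>\<close> can be written without restricting each of them again.
\<close>

definition regular :: "('a \<Rightarrow> complex) \<Rightarrow> bool" where
  "regular s \<longleftrightarrow> restrict s XV \<in> sect X XV"

lemma space_X: "space_with_functions X"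
  and irreducible_X: "irreducible_space (ftop X)"
  and space_Y: "space_with_functions Y"
  using cover by (auto simp: D3_cover_def variety_def)

lemma morphism_pi: "morphism X Y \<pi>"
  and morphism_sigma: "morphism X X \<sigma>"
  and morphism_tau: "morphism X X \<tau>"
  using cover by (auto simp: D3_cover_def finite_morphism_def D3_action_def isomorphism_def)

lemma quotient_iso: "isomorphism (quotient_space X (D3_maps \<sigma> \<tau>)) Y (induced_map \<pi>)"
  using cover by (simp add: D3_cover_def)

lemma quotient_inverse:
  obtains \<psi> where "morphism Y (quotient_space X (D3_maps \<sigma> \<tau>)) \<psi>"
    "\<forall>q\<in>topspace (ftop (quotient_space X (D3_maps \<sigma> \<tau>))). \<psi> (induced_map \<pi> q) = q"
    "\<forall>y\<in>topspace (ftop Y). induced_map \<pi> (\<psi> y) = y"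
proof -
  from quotient_iso[unfolded isomorphism_def, THEN conjunct2] obtain \<psi>
    where "morphism Y (quotient_space X (D3_maps \<sigma> \<tau>)) \<psi> \<and>
      (\<forall>q\<in>topspace (ftop (quotient_space X (D3_maps \<sigma> \<tau>))). \<psi> (induced_map \<pi> q) = q) \<and>
      (\<forall>y\<in>topspace (ftop Y). induced_map \<pi> (\<psi> y) = y)" ..
  then show thesis by (intro that[of \<psi>]) simp_all
qed

lemma XV_topspace: "x \<in> XV \<Longrightarrow> x \<in> topspace (ftop X)"
  and pi_XV: "x \<in> XV \<Longrightarrow> \<pi> x \<in> V"
  by (simp_all add: preim_def)

lemma sigma_topspace: "x \<in> topspace (ftop X) \<Longrightarrow> \<sigma> x \<in> topspace (ftop X)"
  and tau_topspace: "x \<in> topspace (ftop X) \<Longrightarrow> \<tau> x \<in> topspace (ftop X)"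
  using morphism_sigma morphism_tau
  by (auto simp: morphism_def continuous_map_def)

lemma pi_sigma: "x \<in> topspace (ftop X) \<Longrightarrow> \<pi> (\<sigma> x) = \<pi> x"
  and pi_tau: "x \<in> topspace (ftop X) \<Longrightarrow> \<pi> (\<tau> x) = \<pi> x"
  using cover by (auto simp: D3_cover_def)

lemma sigma_XV: "x \<in> XV \<Longrightarrow> \<sigma> x \<in> XV"
  and tau_XV: "x \<in> XV \<Longrightarrow> \<tau> x \<in> XV"
  by (simp_all add: preim_def sigma_topspace tau_topspace pi_sigma pi_tau)

lemma sigma_sigma_sigma: "x \<in> topspace (ftop X) \<Longrightarrow> \<sigma> (\<sigma> (\<sigma> x)) = x"
  and tau_tau: "x \<in> topspace (ftop X) \<Longrightarrow> \<tau> (\<tau> x) = x"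
  and sigma_tau_sigma_tau: "x \<in> topspace (ftop X) \<Longrightarrow> \<sigma> (\<tau> (\<sigma> (\<tau> x))) = x"
  using cover by (auto simp: D3_cover_def D3_action_def numeral_2_eq_2 numeral_3_eq_3)

text \<open>
  The forms of \<open>(\<sigma> \<tau>)\<^sup>2 = 1\<close> and \<open>\<sigma>\<^sup>-\<^sup>1 = \<sigma>\<^sup>2\<close> that move \<open>\<tau>\<close> outwards and inwards.
\<close>

lemma sigma_tau: "x \<in> topspace (ftop X) \<Longrightarrow> \<sigma> (\<tau> x) = \<tau> (\<sigma> (\<sigma> x))"
  by (metis sigma_sigma_sigma tau_tau sigma_tau_sigma_tau sigma_topspace tau_topspace)

lemma tau_sigma: "x \<in> topspace (ftop X) \<Longrightarrow> \<tau> (\<sigma> x) = \<sigma> (\<sigma> (\<tau> x))"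
  by (metis tau_tau sigma_tau sigma_topspace tau_topspace)

lemma open_XV: "openin (ftop X) XV"
  using morphism_pi open_V by (auto simp: morphism_def continuous_map_def preim_def)

lemma sect_X_extensional: "g \<in> sect X XV \<Longrightarrow> g \<in> extensional XV"
  using space_X open_XV by (auto simp: space_with_functions_def)

lemma sect_Y_extensional: "g \<in> sect Y V \<Longrightarrow> g \<in> extensional V"
  using space_Y open_V by (auto simp: space_with_functions_def)

lemma sect_Y_const: "(\<lambda>y\<in>V. c) \<in> sect Y V"
  using space_Y open_V by (auto simp: space_with_functions_def)

lemma sect_Y_times_const:
  assumes "g \<in> sect Y V" shows "(\<lambda>y\<in>V. c * g y) \<in> sect Y V"
proof -
  have "(\<lambda>y\<in>V. (\<lambda>y\<in>V. c) y * g y) \<in> sect Y V"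
    using space_Y open_V assms sect_Y_const[of c] unfolding space_with_functions_def by blast
  also have "(\<lambda>y\<in>V. (\<lambda>y\<in>V. c) y * g y) = (\<lambda>y\<in>V. c * g y)" by (auto simp: restrict_def)
  finally show ?thesis .
qed

section \<open>Regular functions on the preimage\<close>

lemma regular_cong:
  "regular s \<longleftrightarrow> regular t" if "\<And>x. x \<in> XV \<Longrightarrow> s x = t x"
  using that by (simp add: regular_def cong: restrict_cong)

lemma regular_const: "regular (\<lambda>_. c)"
  using space_X open_XV by (auto simp: space_with_functions_def regular_def)

lemma regular_add: "regular (\<lambda>x. s x + t x)"
  and regular_mult: "regular (\<lambda>x. s x * t x)"
  if "regular s" "regular t"
proof -
  have s: "restrict s XV \<in> sect X XV" and t: "restrict t XV \<in> sect X XV"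
    using that by (auto simp: regular_def)
  have "(\<lambda>x\<in>XV. restrict s XV x + restrict t XV x) \<in> sect X XV"
    and "(\<lambda>x\<in>XV. restrict s XV x * restrict t XV x) \<in> sect X XV"
    using space_X open_XV s t unfolding space_with_functions_def by blast+
  then show "regular (\<lambda>x. s x + t x)" "regular (\<lambda>x. s x * t x)"
    by (simp_all add: regular_def cong: restrict_cong)
qed

lemma regular_diff: "regular (\<lambda>x. s x - t x)" if "regular s" "regular t"
  using regular_add[OF that(1) regular_mult[OF regular_const[of "-1"] that(2)]] by simp

lemma regular_power: "regular s \<Longrightarrow> regular (\<lambda>x. s x ^ n)"
  by (induction n) (simp_all add: regular_const regular_mult)

lemma regular_pullback:
  assumes "regular s" "morphism X X g" "preim X g XV = XV"
  shows "regular (\<lambda>x. s (g x))"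
proof -
  have "pullback X g XV (restrict s XV) \<in> sect X (preim X g XV)"
    using assms(1,2) open_XV by (auto simp: regular_def morphism_def)
  moreover have "pullback X g XV (restrict s XV) = restrict (\<lambda>x. s (g x)) XV"
    using assms(3) by (auto simp: pullback_def preim_def fun_eq_iff restrict_def)
  ultimately show ?thesis using assms(3) by (simp add: regular_def)
qed

lemma preim_sigma: "preim X \<sigma> XV = XV" and preim_tau: "preim X \<tau> XV = XV"
  by (auto simp: preim_def pi_sigma pi_tau sigma_topspace tau_topspace)

lemma regular_sigma: "regular s \<Longrightarrow> regular (\<lambda>x. s (\<sigma> x))"
  and regular_tau: "regular s \<Longrightarrow> regular (\<lambda>x. s (\<tau> x))"
  by (simp_all add: regular_pullback morphism_sigma morphism_tau preim_sigma preim_tau)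

lemma regular_pi: "regular (\<lambda>x. a (\<pi> x))" if "a \<in> sect Y V"
  using that morphism_pi open_V by (auto simp: morphism_def pullback_def regular_def)

lemmas regular_intros =
  regular_const regular_add regular_mult regular_diff regular_power regular_sigma regular_tau

text \<open>
  The sections over an open subset of an irreducible space form an integral domain: two nonempty
  open sets, here the sets where \<open>s\<close> and \<open>t\<close> do not vanish, always meet.
\<close>

lemma regular_prod_zero:
  assumes "regular s" "regular t" and zero: "\<And>x. x \<in> XV \<Longrightarrow> s x = 0 \<or> t x = 0"
  shows "(\<forall>x\<in>XV. s x = 0) \<or> (\<forall>x\<in>XV. t x = 0)"
proof -
  have nonzero_open: "openin (ftop X) {x \<in> XV. u x \<noteq> 0}" if "regular u" for u
  proof -
    have "openin (ftop X) {x \<in> XV. restrict u XV x \<noteq> 0}"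
      using space_X open_XV that unfolding space_with_functions_def regular_def by blast
    also have "{x \<in> XV. restrict u XV x \<noteq> 0} = {x \<in> XV. u x \<noteq> 0}" by auto
    finally show ?thesis .
  qed
  let ?S = "{x \<in> XV. s x \<noteq> 0}" and ?T = "{x \<in> XV. t x \<noteq> 0}" and ?top = "topspace (ftop X)"
  have "(?top - ?S) \<union> (?top - ?T) = ?top" using zero by auto
  moreover have "closedin (ftop X) (?top - ?S)" "closedin (ftop X) (?top - ?T)"
    using nonzero_open assms(1,2) by (simp_all add: openin_closedin_eq[symmetric] closedin_diff)
  ultimately have "?top - ?S = ?top \<or> ?top - ?T = ?top"
    using irreducible_X unfolding irreducible_space_def by blast
  then show ?thesis using XV_topspace by blast
qed

section \<open>Descent of invariant functions\<close>

abbreviation D3 :: "('a \<Rightarrow> 'a) set" where "D3 \<equiv> D3_maps \<sigma> \<tau>"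

lemma id_in_D3: "id \<in> D3"
  unfolding D3_maps_def by (rule CollectI, rule exI[of _ 0], rule exI[of _ 0]) auto

lemma D3_invariant:
  assumes "g \<in> D3" "x \<in> S"
    and "\<And>x. x \<in> S \<Longrightarrow> \<sigma> x \<in> S \<and> \<tau> x \<in> S \<and> s (\<sigma> x) = s x \<and> s (\<tau> x) = s x"
  shows "s (g x) = s x"
proof -
  have "(\<tau> ^^ j) x \<in> S \<and> s ((\<tau> ^^ j) x) = s x" for j
    by (induction j) (use assms in auto)
  then have "(\<sigma> ^^ i) ((\<tau> ^^ j) x) \<in> S \<and> s ((\<sigma> ^^ i) ((\<tau> ^^ j) x)) = s x" for i j
    by (induction i) (use assms in auto)
  then show ?thesis using assms(1) by (auto simp: D3_maps_def)
qed

lemma image_D3_orbit: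
  assumes "x \<in> S"
    and "\<And>x. x \<in> S \<Longrightarrow> \<sigma> x \<in> S \<and> \<tau> x \<in> S \<and> s (\<sigma> x) = s x \<and> s (\<tau> x) = s x"
  shows "the_elem (s ` orbit_of D3 x) = s x"
proof -
  have "s (g x) = s x" if "g \<in> D3" for g using D3_invariant that assms by blast
  then have "s ` orbit_of D3 x = {s x}"
    using id_in_D3 by (force simp: orbit_of_def image_iff)
  then show ?thesis by simp
qed

lemma induced_map_D3_orbit:
  "x \<in> topspace (ftop X) \<Longrightarrow> induced_map \<pi> (orbit_of D3 x) = \<pi> x"
  unfolding induced_map_def
  by (rule image_D3_orbit[where S = "topspace (ftop X)"])
    (auto simp: sigma_topspace tau_topspace pi_sigma pi_tau)

lemma topspace_quotient_space: "topspace (ftop (quotient_space X G)) = orbit_of G ` topspace (ftop X)"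
  by (simp add: quotient_space_def topspace_orbit_topology)

lemma pi_surj: "y \<in> V \<Longrightarrow> \<exists>x\<in>XV. \<pi> x = y"
proof -
  assume y: "y \<in> V"
  then have yt: "y \<in> topspace (ftop Y)" using open_V openin_subset by blast
  obtain \<psi> where \<psi>: "morphism Y (quotient_space X D3) \<psi>"
    "\<forall>q\<in>topspace (ftop (quotient_space X D3)). \<psi> (induced_map \<pi> q) = q"
    "\<forall>y\<in>topspace (ftop Y). induced_map \<pi> (\<psi> y) = y"
    by (rule quotient_inverse, rule that)
  have "\<psi> y \<in> orbit_of D3 ` topspace (ftop X)"
    using \<psi>(1) yt unfolding morphism_def continuous_map_def
    by (auto simp: topspace_quotient_space)
  then obtain x where x: "x \<in> topspace (ftop X)" "\<psi> y = orbit_of D3 x" by auto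
  then have "\<pi> x = y" using \<psi>(3)[rule_format, OF yt] induced_map_D3_orbit by simp
  then show ?thesis using x(1) y by (auto simp: preim_def)
qed

text \<open>
  The function \<open>s\<close> is constant on orbits, so it is a section of the quotient \<open>X / D\<^sub>3\<close>, and the
  inverse of the isomorphism \<open>X / D\<^sub>3 \<rightarrow> Y\<close> carries it to \<open>Y\<close>.
\<close>

lemma descent:
  assumes s: "regular s"
    and inv: "\<And>x. x \<in> XV \<Longrightarrow> s (\<sigma> x) = s x" "\<And>x. x \<in> XV \<Longrightarrow> s (\<tau> x) = s x"
  shows "\<exists>a\<in>sect Y V. \<forall>x\<in>XV. a (\<pi> x) = s x"
proof -
  let ?Q = "quotient_space X D3" and ?\<phi> = "induced_map \<pi>"
  obtain \<psi> where \<psi>: "morphism Y ?Q \<psi>"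
    "\<forall>q\<in>topspace (ftop ?Q). \<psi> (?\<phi> q) = q"
    "\<forall>y\<in>topspace (ftop Y). ?\<phi> (\<psi> y) = y"
    by (rule quotient_inverse, rule that)
  have \<phi>: "morphism ?Q Y ?\<phi>" using quotient_iso by (simp add: isomorphism_def)
  let ?QV = "preim ?Q ?\<phi> V"
  have open_QV: "openin (ftop ?Q) ?QV"
    using \<phi> open_V by (auto simp: morphism_def continuous_map_def preim_def)
  have orbit_QV: "orbit_of D3 x \<in> ?QV \<longleftrightarrow> x \<in> XV" if "x \<in> topspace (ftop X)" for x
    using that by (auto simp: preim_def topspace_quotient_space induced_map_D3_orbit)
  have preim_orbit: "preim X (orbit_of D3) ?QV = XV"
    using orbit_QV XV_topspace unfolding preim_def[of X "orbit_of D3"] by blast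
  define g where "g = (\<lambda>q\<in>?QV. the_elem (s ` q))"
  have g_orbit: "g (orbit_of D3 x) = s x" if "x \<in> XV" for x
  proof -
    have "the_elem (s ` orbit_of D3 x) = s x"
      by (rule image_D3_orbit[where S = XV]) (use that inv sigma_XV tau_XV in auto)
    then show ?thesis using orbit_QV that XV_topspace by (simp add: g_def)
  qed
  have "pullback X (orbit_of D3) ?QV g = restrict s XV"
    unfolding pullback_def preim_orbit using g_orbit by (simp cong: restrict_cong)
  then have "g \<in> sect ?Q ?QV"
    using s preim_orbit by (simp add: quotient_space_def regular_def g_def)
  then have "pullback Y \<psi> ?QV g \<in> sect Y (preim Y \<psi> ?QV)"
    using \<psi>(1) open_QV by (auto simp: morphism_def)
  moreover have "preim Y \<psi> ?QV = V"
  proof -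
    have "\<psi> y \<in> topspace (ftop ?Q)" if "y \<in> topspace (ftop Y)" for y
      using \<psi>(1) that by (auto simp: morphism_def continuous_map_def)
    then show ?thesis
      using \<psi>(3) open_V openin_subset[of "ftop Y" V] by (auto simp: preim_def)
  qed
  moreover have "g (\<psi> (\<pi> x)) = s x" if "x \<in> XV" for x
  proof -
    have "\<psi> (\<pi> x) = \<psi> (?\<phi> (orbit_of D3 x))"
      using that by (simp add: induced_map_D3_orbit XV_topspace)
    also have "\<dots> = orbit_of D3 x"
      using that by (intro \<psi>(2)[rule_format]) (auto simp: topspace_quotient_space XV_topspace)
    finally show ?thesis using g_orbit that by simp
  qed
  ultimately show ?thesis
    by (intro bexI[of _ "pullback Y \<psi> ?QV g"]) (auto simp: pullback_def pi_XV)
qed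

section \<open>Decomposition into isotypic components\<close>

text \<open>
  A constant rather than an abbreviation, since the simplifier would rewrite the argument \<open>1\<close>
  to \<open>Suc 0\<close>.
\<close>

definition U1 :: "('a \<Rightarrow> complex) set" where "U1 = U_sect X \<sigma> \<pi> 1 V"

lemma U1_iff: "c \<in> U1 \<longleftrightarrow>
    c \<in> extensional XV \<and> regular c \<and> (\<forall>x\<in>XV. c (\<sigma> x) = \<omega> * c x)"
proof -
  have "c \<in> sect X XV \<longleftrightarrow> c \<in> extensional XV \<and> regular c"
    using sect_X_extensional[of c] by (auto simp: regular_def extensional_restrict)
  then show ?thesis by (auto simp: U1_def U_sect_def \<omega>_def)
qed

lemma U1_sigma: "c \<in> U1 \<Longrightarrow> x \<in> XV \<Longrightarrow> c (\<sigma> x) = \<omega> * c x"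
  by (simp add: U1_iff)

text \<open>
  The function \<open>\<tau>\<^sup>*c\<close> lies in \<open>U\<^sub>2\<close>: it is multiplied by \<open>\<omega>\<^sup>2 = - 1 - \<omega>\<close>.
\<close>

lemma U1_tau_sigma: "c (\<tau> (\<sigma> x)) = - c (\<tau> x) - \<omega> * c (\<tau> x)" if "c \<in> U1" "x \<in> XV"
  using that by (simp add: tau_sigma XV_topspace U1_sigma sigma_XV tau_XV omega_mult_omega)

text \<open>
  The pullback to \<open>X\<close> of the section of \<open>W\<close> identified with \<open>(a, c)\<close>.
\<close>

definition on_X :: "('b \<Rightarrow> complex) \<Rightarrow> ('a \<Rightarrow> complex) \<Rightarrow> 'a \<Rightarrow> complex" where
  "on_X a c x = a (\<pi> x) + c x + c (\<tau> x)"

lemma on_X_conjugate: "on_X a c (\<sigma> x) = a (\<pi> x) + \<omega> * c x + (- c (\<tau> x) - \<omega> * c (\<tau> x))"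
  if "c \<in> U1" "x \<in> XV"
  using that by (simp add: on_X_def pi_sigma XV_topspace U1_sigma U1_tau_sigma)

lemma on_X_conjugate2:
  "on_X a c (\<sigma> (\<sigma> x)) = a (\<pi> x) + (- c x - \<omega> * c x) + \<omega> * c (\<tau> x)"
  if "c \<in> U1" "x \<in> XV"
  using that
  by (simp add: on_X_conjugate sigma_XV pi_sigma XV_topspace U1_sigma U1_tau_sigma)
    (simp add: algebra_simps omega_mult_omega)

lemma on_X_trace:
  "on_X a c x + on_X a c (\<sigma> x) + on_X a c (\<sigma> (\<sigma> x)) = 3 * a (\<pi> x)" if "c \<in> U1" "x \<in> XV"
  using that by (simp add: on_X_conjugate on_X_conjugate2) (simp add: on_X_def)

text \<open>
  The Lagrange resolvent of the conjugates projects onto \<open>U\<^sub>1\<close>, as \<open>1 + \<omega> + \<omega>\<^sup>2 = 0\<close> cancels the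
  other two components.
\<close>

lemma on_X_resolvent:
  "on_X a c x + \<omega>\<^sup>2 * on_X a c (\<sigma> x) + \<omega> * on_X a c (\<sigma> (\<sigma> x)) = 3 * c x"
  if "c \<in> U1" "x \<in> XV"
  using that by (simp add: on_X_conjugate on_X_conjugate2)
    (simp add: on_X_def omega_square algebra_simps omega_mult_omega)

lemma on_X_inj:
  assumes "a \<in> sect Y V" "a' \<in> sect Y V" "c \<in> U1" "c' \<in> U1"
    and eq: "\<And>x. x \<in> XV \<Longrightarrow> on_X a c x = on_X a' c' x"
  shows "a = a' \<and> c = c'"
proof
  have "a (\<pi> x) = a' (\<pi> x)" if "x \<in> XV" for x
    using on_X_trace[OF assms(3) that, of a] on_X_trace[OF assms(4) that, of a']
    by (simp add: eq that sigma_XV)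
  then show "a = a'"
    using assms(1,2) pi_surj sect_Y_extensional by (metis extensionalityI)
  have "c x = c' x" if "x \<in> XV" for x
    using on_X_resolvent[OF assms(3) that, of a] on_X_resolvent[OF assms(4) that, of a']
    by (simp add: eq that sigma_XV)
  then show "c = c'"
    using assms(3,4) by (auto simp: U1_iff intro: extensionalityI)
qed

text \<open>
  The components are found by solving \<open>on_X_trace\<close> and \<open>on_X_resolvent\<close> for \<open>a\<close> and \<open>c\<close>; the
  invariance under \<open>\<tau>\<close> makes the component in \<open>U\<^sub>2\<close> equal to \<open>\<tau>\<^sup>*c\<close>.
\<close>

lemma on_X_surj:
  assumes H: "regular H" and inv: "\<And>x. x \<in> XV \<Longrightarrow> H (\<tau> x) = H x"
  shows "\<exists>a\<in>sect Y V. \<exists>c\<in>U1. \<forall>x\<in>XV. H x = on_X a c x"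
proof -
  have "regular (\<lambda>x. 1 / 3 * (H x + H (\<sigma> x) + H (\<sigma> (\<sigma> x))))"
    by (intro regular_intros H)
  then have "\<exists>a\<in>sect Y V. \<forall>x\<in>XV. a (\<pi> x) = 1 / 3 * (H x + H (\<sigma> x) + H (\<sigma> (\<sigma> x)))"
    by (rule descent)
      (auto simp: inv sigma_sigma_sigma XV_topspace sigma_XV
        tau_XV tau_topspace sigma_topspace sigma_tau)
  then obtain a where a: "a \<in> sect Y V"
    "\<And>x. x \<in> XV \<Longrightarrow> a (\<pi> x) = 1 / 3 * (H x + H (\<sigma> x) + H (\<sigma> (\<sigma> x)))" by blast
  define c0 where "c0 x = 1 / 3 * (H x + \<omega>\<^sup>2 * H (\<sigma> x) + \<omega> * H (\<sigma> (\<sigma> x)))" for x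
  define c where "c = restrict c0 XV"
  have "regular c0" unfolding c0_def by (intro regular_intros H)
  then have "regular c" using regular_cong[of c0 c] by (simp add: c_def)
  moreover have "c (\<sigma> x) = \<omega> * c x" if "x \<in> XV" for x
    using that by (simp add: c_def c0_def sigma_XV sigma_sigma_sigma XV_topspace)
      (simp add: omega_square algebra_simps omega_mult_omega)
  ultimately have "c \<in> U1" by (simp add: U1_iff c_def)
  moreover have "H x = on_X a c x" if "x \<in> XV" for x
    using that by (simp add: on_X_def a c_def c0_def tau_XV sigma_XV inv sigma_tau
          XV_topspace sigma_topspace sigma_sigma_sigma)
      (simp add: omega_square field_simps)
  ultimately show ?thesis using a(1) by blast
qed

lemma on_X_sigma_invariant:
  assumes "c \<in> U1" "x \<in> XV" and "\<And>x. x \<in> XV \<Longrightarrow> on_X a c (\<sigma> x) = on_X a c x"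
  shows "c x = 0"
  using on_X_resolvent[OF assms(1,2), of a] assms(2,3)
  by (simp add: sigma_XV omega_square algebra_simps)

text \<open>
  The hypothesis says that \<open>t\<close> times the three differences of conjugates of \<open>H\<close> is zero, so one of
  these four factors vanishes identically. The differences are, up to sign, translates of
  \<open>H - \<sigma>\<^sup>*H\<close> under \<open>\<sigma>\<close>, so if any of them vanishes then so does \<open>H - \<sigma>\<^sup>*H\<close> itself. The factor
  \<open>t\<close> serves to exclude the points where the hypothesis on \<open>H\<close> is not available.
\<close>

lemma conjugates_coincide:
  assumes t: "regular t" and H: "regular H"
    and zero: "\<And>x. x \<in> XV \<Longrightarrow>
      t x = 0 \<or> H x = H (\<sigma> x) \<or> H (\<sigma> x) = H (\<sigma> (\<sigma> x)) \<or> H x = H (\<sigma> (\<sigma> x))"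
  shows "(\<forall>x\<in>XV. t x = 0) \<or> (\<forall>x\<in>XV. H (\<sigma> x) = H x)"
proof -
  define D where "D x = H x - H (\<sigma> x)" for x
  have D: "regular D" unfolding D_def by (intro regular_intros H)
  note D' = regular_sigma[OF D]
  note D'' = regular_sigma[OF D']
  have "t x = 0 \<or> D x * (D (\<sigma> x) * D (\<sigma> (\<sigma> x))) = 0" if "x \<in> XV" for x
    using zero[OF that] that by (auto simp: D_def sigma_sigma_sigma XV_topspace)
  then have "(\<forall>x\<in>XV. t x = 0) \<or> (\<forall>x\<in>XV. D x * (D (\<sigma> x) * D (\<sigma> (\<sigma> x))) = 0)"
    by (rule regular_prod_zero[OF t regular_mult[OF D regular_mult[OF D' D'']]])
  then show ?thesis
  proof
    assume "\<forall>x\<in>XV. D x * (D (\<sigma> x) * D (\<sigma> (\<sigma> x))) = 0"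
    then have "(\<forall>x\<in>XV. D x = 0) \<or> (\<forall>x\<in>XV. D (\<sigma> x) * D (\<sigma> (\<sigma> x)) = 0)"
      by (intro regular_prod_zero[OF D regular_mult[OF D' D'']]) (simp only: mult_eq_0_iff)
    moreover have "(\<forall>x\<in>XV. D (\<sigma> x) = 0) \<or> (\<forall>x\<in>XV. D (\<sigma> (\<sigma> x)) = 0)"
      if "\<forall>x\<in>XV. D (\<sigma> x) * D (\<sigma> (\<sigma> x)) = 0"
      using that by (intro regular_prod_zero[OF D' D'']) (simp only: mult_eq_0_iff)
    ultimately consider "\<forall>x\<in>XV. D x = 0" | "\<forall>x\<in>XV. D (\<sigma> x) = 0"
      | "\<forall>x\<in>XV. D (\<sigma> (\<sigma> x)) = 0" by argo
    then have "\<forall>x\<in>XV. D x = 0"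
    proof cases
      case 2
      have "D x = 0" if "x \<in> XV" for x
        using 2[rule_format, of "\<sigma> (\<sigma> x)"] that by (simp add: sigma_XV sigma_sigma_sigma XV_topspace)
      then show ?thesis ..
    next
      case 3
      have "D x = 0" if "x \<in> XV" for x
        using 3[rule_format, of "\<sigma> x"] that by (simp add: sigma_XV sigma_sigma_sigma XV_topspace)
      then show ?thesis ..
    qed
    then show ?thesis by (simp add: D_def)
  qed simp
qed

section \<open>The quotient by the involution\<close>

abbreviation W :: "'a set funspace" where "W \<equiv> quotient_space X {id, \<tau>}"
abbreviation f :: "'a set \<Rightarrow> 'b" where "f \<equiv> induced_map \<pi>"
abbreviation WV :: "'a set set" where "WV \<equiv> preim W f V"
abbreviation orb :: "'a \<Rightarrow> 'a set" where "orb \<equiv> orbit_of {id, \<tau>}"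

lemma orb_eq: "orb x = {x, \<tau> x}"
  by (auto simp: orbit_of_def)

lemma orb_tau: "x \<in> XV \<Longrightarrow> orb (\<tau> x) = orb x"
  by (auto simp: orb_eq tau_tau XV_topspace)

lemma f_orb: "x \<in> topspace (ftop X) \<Longrightarrow> f (orb x) = \<pi> x"
  by (simp add: induced_map_def orb_eq pi_tau)

lemma orb_WV: "x \<in> topspace (ftop X) \<Longrightarrow> orb x \<in> WV \<longleftrightarrow> x \<in> XV"
  by (auto simp: preim_def topspace_quotient_space f_orb)

lemma WV_eq: "WV = orb ` XV"
proof (intro subset_antisym subsetI)
  fix w assume w: "w \<in> WV"
  then have "w \<in> orb ` topspace (ftop X)" by (simp add: preim_def topspace_quotient_space)
  then obtain x where "x \<in> topspace (ftop X)" "w = orb x" by blast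
  then show "w \<in> orb ` XV" using w orb_WV by simp
next
  fix w assume "w \<in> orb ` XV"
  then obtain x where "x \<in> XV" "w = orb x" by blast
  then show "w \<in> WV" using orb_WV XV_topspace by simp
qed

lemma sect_W_iff: "h \<in> sect W WV \<longleftrightarrow> h \<in> extensional WV \<and> regular (\<lambda>x. h (orb x))"
proof -
  have "preim X orb WV = XV"
    using orb_WV XV_topspace unfolding preim_def[of X orb] by blast
  then show ?thesis by (simp add: quotient_space_def regular_def pullback_def)
qed

lemma sect_W_eqI:
  assumes "h \<in> extensional WV" "h' \<in> extensional WV" "\<And>x. x \<in> XV \<Longrightarrow> h (orb x) = h' (orb x)"
  shows "h = h'"
  using assms by (intro extensionalityI[of h WV h']) (auto simp: WV_eq)

abbreviation ident :: "('b \<Rightarrow> complex) \<Rightarrow> ('a \<Rightarrow> complex) \<Rightarrow> 'a set \<Rightarrow> complex" where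
  "ident a c \<equiv> identification X \<tau> \<pi> V a c"

lemma ident_orb: "x \<in> XV \<Longrightarrow> ident a c (orb x) = on_X a c x"
proof -
  assume x: "x \<in> XV"
  have "(\<lambda>x. a (\<pi> x) + c x + c (\<tau> x)) ` orb x = {on_X a c x}"
    using x by (auto simp: orb_eq on_X_def pi_tau tau_tau XV_topspace)
  then show ?thesis using x by (simp add: identification_def WV_eq)
qed

lemma ident_extensional: "ident a c \<in> extensional WV"
  by (simp add: identification_def)

lemma regular_on_X: "a \<in> sect Y V \<Longrightarrow> c \<in> U1 \<Longrightarrow> regular (on_X a c)"
  unfolding on_X_def[abs_def] by (intro regular_intros regular_pi) (auto simp: U1_iff)

lemma ident_sect: "ident a c \<in> sect W WV" if "a \<in> sect Y V" "c \<in> U1"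
  using regular_cong[of "on_X a c" "\<lambda>x. ident a c (orb x)"] regular_on_X[OF that]
  by (simp add: sect_W_iff ident_extensional ident_orb)

lemma ident_inj:
  assumes "a \<in> sect Y V" "a' \<in> sect Y V" "c \<in> U1" "c' \<in> U1" "ident a c = ident a' c'"
  shows "a = a' \<and> c = c'"
  using on_X_inj[OF assms(1-4)] assms(5) by (metis ident_orb)

lemma ident_surj:
  assumes "h \<in> sect W WV"
  shows "\<exists>a\<in>sect Y V. \<exists>c\<in>U1. h = ident a c"
proof -
  have "\<exists>a\<in>sect Y V. \<exists>c\<in>U1. \<forall>x\<in>XV. h (orb x) = on_X a c x"
    by (rule on_X_surj) (use assms in \<open>auto simp: sect_W_iff orb_tau\<close>)
  then obtain a c where "a \<in> sect Y V" "c \<in> U1" "\<forall>x\<in>XV. h (orb x) = on_X a c x" by blast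
  moreover from this have "h = ident a c"
    using assms by (intro sect_W_eqI) (auto simp: sect_W_iff ident_extensional ident_orb)
  ultimately show ?thesis by blast
qed

lemma bij_betw_ident: "bij_betw (\<lambda>(a, c). ident a c) (sect Y V \<times> U1) (sect W WV)"
  unfolding bij_betw_def
proof
  show "inj_on (\<lambda>(a, c). ident a c) (sect Y V \<times> U1)"
    by (auto intro!: inj_onI dest: ident_inj)
  show "(\<lambda>(a, c). ident a c) ` (sect Y V \<times> U1) = sect W WV"
    using ident_sect ident_surj by fastforce
qed

section \<open>Cubic equations of sections and the Tschirnhausen module\<close>

lemma annihilates_iff:
  "annihilates W f V p h \<longleftrightarrow> (\<forall>x\<in>XV. poly (p (\<pi> x)) (h (orb x)) = 0)"
  by (auto simp: annihilates_def WV_eq f_orb XV_topspace)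

lemma annihilates_ident_iff:
  "annihilates W f V p (ident a c) \<longleftrightarrow> (\<forall>x\<in>XV. poly (p (\<pi> x)) (on_X a c x) = 0)"
  by (simp add: annihilates_iff ident_orb)

text \<open>
  The coefficients of \<open>p\<close> come from \<open>Y\<close>, so they do not change when \<open>x\<close> is replaced by \<open>\<sigma> x\<close>.
\<close>

lemma annihilates_conjugates:
  assumes "annihilates W f V p (ident a c)" "x \<in> XV"
  shows "poly (p (\<pi> x)) (on_X a c x) = 0" "poly (p (\<pi> x)) (on_X a c (\<sigma> x)) = 0"
    "poly (p (\<pi> x)) (on_X a c (\<sigma> (\<sigma> x))) = 0"
  using assms sigma_XV[OF assms(2)] sigma_XV[OF sigma_XV[OF assms(2)]]
  unfolding annihilates_ident_iff by (metis pi_sigma XV_topspace)+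

text \<open>
  The three conjugates are roots of a polynomial of degree less than 3, so two of them agree at each
  point, and \<open>conjugates_coincide\<close> applies with \<open>t = 1\<close>.
\<close>

lemma low_degree_imp_zero:
  assumes "a \<in> sect Y V" "c \<in> U1" "monic_over Y V k q" "annihilates W f V q (ident a c)" "k < 3"
    and "x \<in> XV"
  shows "c x = 0"
proof -
  let ?H = "on_X a c"
  have "?H x = ?H (\<sigma> x) \<or> ?H (\<sigma> x) = ?H (\<sigma> (\<sigma> x)) \<or> ?H x = ?H (\<sigma> (\<sigma> x))" if "x \<in> XV" for x
  proof (rule few_roots_coincide)
    show "q (\<pi> x) \<noteq> 0" "Polynomial.degree (q (\<pi> x)) < 3"
      using assms(3,5) pi_XV[OF that] by (auto simp: monic_over_def)
  qed (rule annihilates_conjugates[OF assms(4) that])+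
  then have "(\<forall>x\<in>XV. (1 :: complex) = 0) \<or> (\<forall>x\<in>XV. ?H (\<sigma> x) = ?H x)"
    by (intro conjugates_coincide regular_const regular_on_X assms(1,2)) auto
  with assms(6) have "\<forall>x\<in>XV. ?H (\<sigma> x) = ?H x" by auto
  then show ?thesis using on_X_sigma_invariant[OF assms(2,6)] by blast
qed

abbreviation zeroV :: "'b \<Rightarrow> complex" where "zeroV \<equiv> (\<lambda>y\<in>V. 0)"

lemma on_X_zero: "x \<in> XV \<Longrightarrow> on_X zeroV c x = c x + c (\<tau> x)"
  by (simp add: on_X_def pi_XV)

text \<open>
  Only the coefficients below the leading one need to be checked for regularity; the others are
  the constants 1 and 0.
\<close>

lemma monic_overI:
  assumes "\<And>i. i < n \<Longrightarrow> (\<lambda>y\<in>V. Polynomial.coeff (p y) i) \<in> sect Y V"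
    and "\<And>y. y \<in> V \<Longrightarrow> Polynomial.degree (p y) = n \<and> Polynomial.coeff (p y) n = 1"
  shows "monic_over Y V n p"
  unfolding monic_over_def
proof (intro conjI allI ballI)
  fix i
  consider "i < n" | "i = n" | "n < i" by linarith
  then show "(\<lambda>y\<in>V. Polynomial.coeff (p y) i) \<in> sect Y V"
  proof cases
    case 2
    then have "(\<lambda>y\<in>V. Polynomial.coeff (p y) i) = (\<lambda>y\<in>V. 1)" using assms(2) by (auto simp: restrict_def)
    then show ?thesis using sect_Y_const by metis
  next
    case 3
    then have "(\<lambda>y\<in>V. Polynomial.coeff (p y) i) = (\<lambda>y\<in>V. 0)"
      using assms(2) by (auto simp: restrict_def coeff_eq_0)
    then show ?thesis using sect_Y_const by metis
  qed (use assms in auto)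
qed (use assms in auto)

text \<open>
  The Cardano cubic has coefficients invariant under \<open>D\<^sub>3\<close>, since \<open>\<sigma>\<close> multiplies \<open>c\<close> and \<open>\<tau>\<^sup>*c\<close> by
  inverse cube roots of unity and \<open>\<tau>\<close> exchanges them. It is the minimal polynomial unless \<open>c\<close>
  is zero, and then it is the cube of the minimal polynomial \<open>z\<close>.
\<close>

lemma ident_in_tschirnhausen:
  assumes c: "c \<in> U1"
  shows "ident zeroV c \<in> tschirnhausen W Y f V"
proof -
  have reg: "regular c" using c by (simp add: U1_iff)
  have "regular (\<lambda>x. c x * c (\<tau> x))" by (intro regular_intros reg)
  then have "\<exists>A\<in>sect Y V. \<forall>x\<in>XV. A (\<pi> x) = c x * c (\<tau> x)"
    by (rule descent) (use c in \<open>auto simp: U1_sigma U1_tau_sigma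
      tau_tau XV_topspace omega_mult_omega algebra_simps\<close>)
  then obtain A where A: "A \<in> sect Y V" "\<And>x. x \<in> XV \<Longrightarrow> A (\<pi> x) = c x * c (\<tau> x)" by blast
  have cube: "c (\<sigma> x) ^ 3 = c x ^ 3" "c (\<tau> (\<sigma> x)) ^ 3 = c (\<tau> x) ^ 3" if "x \<in> XV" for x
    using c that omega_cube
    by (simp_all add: tau_sigma XV_topspace U1_sigma sigma_XV tau_XV power_mult_distrib)
  have "regular (\<lambda>x. c x ^ 3 + c (\<tau> x) ^ 3)" by (intro regular_intros reg)
  then have "\<exists>B\<in>sect Y V. \<forall>x\<in>XV. B (\<pi> x) = c x ^ 3 + c (\<tau> x) ^ 3"
    by (rule descent) (auto simp: cube tau_tau XV_topspace)
  then obtain B where B: "B \<in> sect Y V" "\<And>x. x \<in> XV \<Longrightarrow> B (\<pi> x) = c x ^ 3 + c (\<tau> x) ^ 3"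
    by blast
  define p where "p y = [:- B y, - 3 * A y, 0, 1:]" for y
  have monic: "monic_over Y V 3 p"
  proof (rule monic_overI)
    fix i :: nat assume "i < 3"
    then consider "i = 0" | "i = 1" | "i = 2" by linarith
    then show "(\<lambda>y\<in>V. Polynomial.coeff (p y) i) \<in> sect Y V"
    proof cases
      case 1 then show ?thesis using sect_Y_times_const[OF B(1), of "-1"] by (simp add: p_def)
    next
      case 2 then show ?thesis using sect_Y_times_const[OF A(1), of "-3"] by (simp add: p_def)
    next
      case 3 then show ?thesis using sect_Y_const[of 0] by (simp add: p_def numeral_2_eq_2)
    qed
  qed (simp add: p_def numeral_3_eq_3)
  have ann: "annihilates W f V p (ident zeroV c)"
    using cardano_cubic_root by (simp add: annihilates_ident_iff on_X_zero p_def A(2) B(2))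
  have "minimal_cubic W Y f V (ident zeroV c) p"
  proof (cases "\<forall>x\<in>XV. c x = 0")
    case True
    define m :: "'b \<Rightarrow> complex poly" where "m y = [:0, 1:]" for y
    have "monic_over Y V 1 m"
      by (rule monic_overI) (use sect_Y_const[of 0] in \<open>auto simp: m_def\<close>)
    moreover have "annihilates W f V m (ident zeroV c)"
      using True by (simp add: annihilates_ident_iff on_X_zero m_def tau_XV)
    ultimately have "minimal_poly W Y f V (ident zeroV c) 1 m" by (auto simp: minimal_poly_def)
    moreover have "p y = m y ^ 3" if y: "y \<in> V" for y
    proof -
      obtain x where x: "x \<in> XV" "\<pi> x = y" using pi_surj[OF y] by blast
      then have "A y = 0" "B y = 0" using A(2)[of x] B(2)[of x] True tau_XV by auto
      then show ?thesis by (simp add: p_def m_def power3_eq_cube)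
    qed
    ultimately show ?thesis using monic unfolding minimal_cubic_def by blast
  next
    case False
    then have "\<not> (monic_over Y V k q \<and> annihilates W f V q (ident zeroV c))" if "k < 3" for k q
      using low_degree_imp_zero[OF sect_Y_const c] that by blast
    with monic ann have "minimal_poly W Y f V (ident zeroV c) 3 p" by (auto simp: minimal_poly_def)
    then show ?thesis using monic unfolding minimal_cubic_def by (metis power_one_right)
  qed
  then show ?thesis
    using ident_sect[OF sect_Y_const c]
    by (auto simp: tschirnhausen_def p_def numeral_2_eq_2)
qed

text \<open>
  A power of the minimal polynomial that is cubic has positive exponent, so it vanishes where the
  minimal polynomial does.
\<close>

lemma minimal_cubic_annihilates:
  assumes "minimal_cubic W Y f V h p"
  shows "annihilates W f V p h"
proof -
  obtain n m k where m: "minimal_poly W Y f V h n m" "\<forall>y\<in>V. p y = m y ^ k"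
    and p: "monic_over Y V 3 p" using assms by (auto simp: minimal_cubic_def)
  show ?thesis unfolding annihilates_iff
  proof
    fix x assume x: "x \<in> XV"
    have "k \<noteq> 0" using p m(2) pi_XV[OF x] by (metis monic_over_def degree_1 power_0 zero_neq_numeral)
    then show "poly (p (\<pi> x)) (h (orb x)) = 0"
      using m pi_XV[OF x] x by (simp add: minimal_poly_def annihilates_iff poly_power)
  qed
qed

text \<open>
  For a function pulled back from \<open>Y\<close> the minimal polynomial is some \<open>z + b\<close>, and the coefficient of
  \<open>z\<^sup>2\<close> in \<open>(z + b)\<^sup>3\<close> is \<open>3 b\<close>.
\<close>

lemma traceless_constant_is_zero:
  assumes a: "a \<in> sect Y V" and h: "\<And>x. x \<in> XV \<Longrightarrow> h (orb x) = a (\<pi> x)"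
    and p: "minimal_cubic W Y f V h p" and traceless: "\<forall>y\<in>V. Polynomial.coeff (p y) 2 = 0"
    and x: "x \<in> XV"
  shows "a (\<pi> x) = 0"
proof -
  obtain n m k where m: "minimal_poly W Y f V h n m" "\<forall>y\<in>V. p y = m y ^ k"
    and p: "monic_over Y V 3 p" using p by (auto simp: minimal_cubic_def)
  have "monic_over Y V 1 (\<lambda>y. [:- a y, 1:])"
    by (rule monic_overI) (use sect_Y_times_const[OF a, of "-1"] in auto)
  moreover have "annihilates W f V (\<lambda>y. [:- a y, 1:]) h" by (simp add: annihilates_iff h)
  ultimately have n: "n = 1" using m(1) unfolding minimal_poly_def
    by (metis less_one linorder_neqE_nat)
  let ?y = "\<pi> x"
  have mon: "Polynomial.degree (m ?y) = 1" "Polynomial.coeff (m ?y) 1 = 1"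
    using m(1) n pi_XV[OF x] by (auto simp: minimal_poly_def monic_over_def)
  define b where "b = Polynomial.coeff (m ?y) 0"
  have my: "m ?y = [:b, 1:]"
    using mon by (auto simp: b_def intro!: poly_eqI simp: coeff_pCons coeff_eq_0 split: nat.split)
  have "Polynomial.degree (m ?y ^ k) = 3" using p m(2) pi_XV[OF x] by (metis monic_over_def)
  then have "k = 3" using mon by (simp add: degree_power_eq my)
  then have "Polynomial.coeff ([:b, 1:] ^ 3) 2 = 0" using traceless m(2) pi_XV[OF x] my by metis
  then have "b = 0" by (simp add: power3_eq_cube numeral_2_eq_2)
  moreover have "poly (m ?y) (h (orb x)) = 0"
    using m(1) x by (simp add: minimal_poly_def annihilates_iff)
  ultimately show ?thesis using my h x by simp
qed

text \<open>
  Where the three conjugates are distinct, Vieta's formula identifies \<open>3 a\<close> with minus the square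
  coefficient, which is zero. So \<open>conjugates_coincide\<close> applies with \<open>t = a\<close>; in the case where the
  conjugates coincide, \<open>c\<close> vanishes and the function comes from \<open>Y\<close>.
\<close>

lemma tschirnhausen_subset:
  assumes "h \<in> tschirnhausen W Y f V"
  shows "\<exists>c\<in>U1. h = ident zeroV c"
proof -
  obtain p where h: "h \<in> sect W WV" and p: "minimal_cubic W Y f V h p"
    and traceless: "\<forall>y\<in>V. Polynomial.coeff (p y) 2 = 0"
    using assms by (auto simp: tschirnhausen_def)
  obtain a c where a: "a \<in> sect Y V" and c: "c \<in> U1" and h_eq: "h = ident a c"
    using ident_surj h by blast
  have ann: "annihilates W f V p (ident a c)" using minimal_cubic_annihilates p h_eq by simp
  let ?H = "on_X a c"
  have "a (\<pi> x) = 0 \<or> ?H x = ?H (\<sigma> x) \<or> ?H (\<sigma> x) = ?H (\<sigma> (\<sigma> x)) \<or> ?H x = ?H (\<sigma> (\<sigma> x))"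
    if x: "x \<in> XV" for x
  proof (rule ccontr)
    assume distinct: "\<not> ?thesis"
    have "Polynomial.coeff (p (\<pi> x)) 2 = - (?H x + ?H (\<sigma> x) + ?H (\<sigma> (\<sigma> x)))"
      by (rule cubic_sum_of_roots)
        (use p pi_XV[OF x] annihilates_conjugates[OF ann x] distinct
         in \<open>auto simp: minimal_cubic_def monic_over_def\<close>)
    then show False using on_X_trace[OF c x, of a] traceless pi_XV[OF x] distinct by auto
  qed
  then have "(\<forall>x\<in>XV. a (\<pi> x) = 0) \<or> (\<forall>x\<in>XV. ?H (\<sigma> x) = ?H x)"
    by (intro conjugates_coincide regular_pi a regular_on_X c) auto
  moreover have "a (\<pi> x) = 0" if "\<forall>x\<in>XV. ?H (\<sigma> x) = ?H x" and x: "x \<in> XV" for x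
  proof (rule traceless_constant_is_zero[OF a _ p traceless x])
    have "c x = 0" if "x \<in> XV" for x using on_X_sigma_invariant c that \<open>\<forall>x\<in>XV. _ x\<close> by blast
    then show "h (orb x) = a (\<pi> x)" if "x \<in> XV" for x
      using that by (simp add: h_eq ident_orb on_X_def tau_XV)
  qed
  ultimately have "\<forall>x\<in>XV. a (\<pi> x) = 0" by blast
  then have "\<forall>y\<in>V. a y = 0" using pi_surj by blast
  then have "a = zeroV" using sect_Y_extensional[OF a] by (auto intro: extensionalityI)
  then show ?thesis using c h_eq by blast
qed

lemma tschirnhausen_eq: "tschirnhausen W Y f V = ident zeroV ` U1"
  using tschirnhausen_subset ident_in_tschirnhausen by blast

section \<open>The product on the Tschirnhausen module\<close>

lemma m11_eq: "x \<in> XV \<Longrightarrow> m11 X \<tau> \<pi> V c d x = c (\<tau> x) * d (\<tau> x)"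
  by (simp add: m11_def pullback_def preim_tau tau_XV)

text \<open>
  The function \<open>c d\<close> has character \<open>\<omega>\<^sup>2\<close>, and \<open>\<tau>\<^sup>*\<close> turns it into \<open>\<omega>\<^sup>4 = \<omega>\<close>.
\<close>

lemma m11_in_U1:
  assumes "c \<in> U1" "d \<in> U1"
  shows "m11 X \<tau> \<pi> V c d \<in> U1"
proof -
  let ?m = "m11 X \<tau> \<pi> V c d"
  have "regular (\<lambda>x. c (\<tau> x) * d (\<tau> x))"
    using assms by (intro regular_intros) (auto simp: U1_iff)
  then have "regular ?m" using regular_cong[of ?m] by (simp add: m11_eq)
  moreover have "?m \<in> extensional XV" by (simp add: m11_def pullback_def preim_tau)
  moreover have "?m (\<sigma> x) = \<omega> * ?m x" if "x \<in> XV" for x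
    using assms that by (simp add: m11_eq sigma_XV U1_tau_sigma)
      (simp add: algebra_simps omega_mult_omega)
  ultimately show ?thesis by (simp add: U1_iff)
qed

text \<open>
  The mixed terms \<open>c \<tau>\<^sup>*d + d \<tau>\<^sup>*c\<close> are invariant and give \<open>a\<close>; the terms \<open>c d\<close> and
  \<open>\<tau>\<^sup>*c \<tau>\<^sup>*d\<close> form the pullback of the section identified with \<open>(0, m\<^sub>1\<^sub>1(c, d))\<close>.
\<close>

lemma ident_product:
  assumes c: "c \<in> U1" and d: "d \<in> U1"
  shows "\<exists>a\<in>sect Y V. \<forall>x\<in>XV.
    on_X zeroV c x * on_X zeroV d x = a (\<pi> x) + on_X zeroV (m11 X \<tau> \<pi> V c d) x"
proof -
  have reg: "regular c" "regular d" using c d by (auto simp: U1_iff)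
  have "regular (\<lambda>x. c x * d (\<tau> x) + c (\<tau> x) * d x)" by (intro regular_intros reg)
  then have "\<exists>a\<in>sect Y V. \<forall>x\<in>XV. a (\<pi> x) = c x * d (\<tau> x) + c (\<tau> x) * d x"
    by (rule descent) (use c d in \<open>auto simp: U1_sigma U1_tau_sigma
      tau_tau XV_topspace omega_mult_omega algebra_simps\<close>)
  then show ?thesis
    by (auto elim!: rev_bexI simp: on_X_zero m11_eq tau_XV tau_tau XV_topspace algebra_simps)
qed

lemma phi2_ident:
  assumes c: "c \<in> U1" and d: "d \<in> U1"
  shows "phi2 W Y f V (ident zeroV c) (ident zeroV d) = ident zeroV (m11 X \<tau> \<pi> V c d)"
  unfolding phi2_def
proof (rule the_equality)
  let ?m = "m11 X \<tau> \<pi> V c d"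
  obtain a where a: "a \<in> sect Y V"
    "\<And>x. x \<in> XV \<Longrightarrow> on_X zeroV c x * on_X zeroV d x = a (\<pi> x) + on_X zeroV ?m x"
    using ident_product[OF c d] by blast
  show "ident zeroV ?m \<in> tschirnhausen W Y f V \<and> (\<exists>a\<in>sect Y V. \<forall>w\<in>WV.
      ident zeroV c w * ident zeroV d w = a (f w) + ident zeroV ?m w)"
    using a m11_in_U1[OF c d] ident_in_tschirnhausen
    by (auto simp: WV_eq ident_orb f_orb XV_topspace intro!: bexI[of _ a])
  fix e assume e: "e \<in> tschirnhausen W Y f V \<and> (\<exists>a\<in>sect Y V. \<forall>w\<in>WV.
      ident zeroV c w * ident zeroV d w = a (f w) + e w)"
  then obtain c' a' where c': "c' \<in> U1" "e = ident zeroV c'" and a': "a' \<in> sect Y V"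
    "\<And>x. x \<in> XV \<Longrightarrow> on_X zeroV c x * on_X zeroV d x = a' (\<pi> x) + on_X zeroV c' x"
    using tschirnhausen_subset by (fastforce simp: WV_eq ident_orb f_orb XV_topspace)
  have "on_X a' c' x = on_X a ?m x" if "x \<in> XV" for x
    using a(2)[OF that] a'(2)[OF that] that by (simp add: on_X_zero) (simp add: on_X_def add.assoc)
  then have "c' = ?m" using on_X_inj[OF a'(1) a(1) c'(1) m11_in_U1[OF c d]] by blast
  then show "e = ident zeroV ?m" using c' by simp
qed

end

section \<open>The Tschirnhausen module of the triple cover\<close>

theorem proposition5p9:
  fixes X :: "'a funspace" and Y :: "'b funspace" and W :: "'a set funspace"
    and \<sigma> \<tau> :: "'a \<Rightarrow> 'a" and \<pi> :: "'a \<Rightarrow> 'b" and f :: "'a set \<Rightarrow> 'b"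
  assumes "smooth_variety Y"
    and "normal_variety X"
    and "D3_cover X Y \<sigma> \<tau> \<pi>"
    and "flat_morphism X Y \<pi>"
    and "W = quotient_space X {id, \<tau>}"
    and "f = induced_map \<pi>"
  shows "\<forall>V. openin (ftop Y) V \<longrightarrow>
    bij_betw (\<lambda>(a, c). identification X \<tau> \<pi> V a c)
      (sect Y V \<times> U_sect X \<sigma> \<pi> 1 V) (sect W (preim W f V)) \<and>
    tschirnhausen W Y f V =
      (\<lambda>c. identification X \<tau> \<pi> V (\<lambda>y\<in>V. 0) c) ` U_sect X \<sigma> \<pi> 1 V \<and>
    (\<forall>c\<in>U_sect X \<sigma> \<pi> 1 V. \<forall>d\<in>U_sect X \<sigma> \<pi> 1 V.
      phi2 W Y f V (identification X \<tau> \<pi> V (\<lambda>y\<in>V. 0) c)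
                   (identification X \<tau> \<pi> V (\<lambda>y\<in>V. 0) d) =
      identification X \<tau> \<pi> V (\<lambda>y\<in>V. 0) (m11 X \<tau> \<pi> V c d))"
proof (intro allI impI)
  fix V assume "openin (ftop Y) V"
  with assms(3) interpret D3_cover_over_open X Y \<sigma> \<tau> \<pi> V by unfold_locales
  show "bij_betw (\<lambda>(a, c). identification X \<tau> \<pi> V a c)
      (sect Y V \<times> U_sect X \<sigma> \<pi> 1 V) (sect W (preim W f V)) \<and>
    tschirnhausen W Y f V =
      (\<lambda>c. identification X \<tau> \<pi> V (\<lambda>y\<in>V. 0) c) ` U_sect X \<sigma> \<pi> 1 V \<and>
    (\<forall>c\<in>U_sect X \<sigma> \<pi> 1 V. \<forall>d\<in>U_sect X \<sigma> \<pi> 1 V.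
      phi2 W Y f V (identification X \<tau> \<pi> V (\<lambda>y\<in>V. 0) c)
                   (identification X \<tau> \<pi> V (\<lambda>y\<in>V. 0) d) =
      identification X \<tau> \<pi> V (\<lambda>y\<in>V. 0) (m11 X \<tau> \<pi> V c d))"
    unfolding assms(5,6) U1_def[symmetric]
    using bij_betw_ident tschirnhausen_eq phi2_ident by blast
qed

end
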